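(* Let $L=(l_{i,j})$ be a Latin square of order $n$ and let $\Theta=(\alpha,\beta,\gamma)$ be an autotopism of $L$. Let $C^\alpha$ be a cycle of $\alpha$ of length $\lambda^\alpha$ and $C^\beta$ a cycle of $\beta$ of length $\lambda^\beta$, and put $m=\mathrm{lcm}(\lambda^\alpha,\lambda^\beta)$. Let $a$ be an element of $C^\alpha$, $b$ an element of $C^\beta$, and let $C^\gamma$ be the cycle of $\gamma$ containing $l_{a,b}$, of length $\lambda^\gamma$. Then: (i) $\lambda^\gamma$ divides $m$; (ii) $\lambda^\gamma$ does not divide any positive multiple of $\lambda^\alpha$ smaller than $m$; (iii) $\lambda^\gamma$ does not divide any positive multiple of $\lambda^\beta$ smaller than $m$; (iv) if $\gcd(\lambda^\alpha,\lambda^\beta)=1$, then $\lambda^\gamma=m$.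
   Context: Let $N=\{0,1,\dots,n-1\}$ and $S_n$ the symmetric group on $N$. A Latin square of order $n$ is an $n\times n$ array $L=(l_{i,j})_{i,j\in N}$ with entries in $N$ in which each symbol occurs exactly once in each row and each column. For $\Theta=(\alpha,\beta,\gamma)\in S_n^3$, $L^{\Theta}$ is the array with $(i,j)$ entry $\gamma^{-1}(l_{\alpha(i),\beta(j)})$; $\Theta$ is an autotopism of $L$ if $L^\Theta=L$. Cycles refer to the disjoint cycle decomposition of a permutation, fixed points being cycles of length 1. *)

theory Defs
  imports "HOL-Combinatorics.Orbits"
begin

text \<open>
  An array of order \<open>n\<close> is a function \<open>nat \<Rightarrow> nat \<Rightarrow> nat\<close> of which only the values at
  indices below \<open>n\<close> matter.  The symmetric group on \<open>{..<n}\<close> consists of the functions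
  \<open>f\<close> with \<open>f permutes {..<n}\<close>, so \<open>inv\<close> is inversion in that group.
\<close>

definition latin_square :: "nat \<Rightarrow> (nat \<Rightarrow> nat \<Rightarrow> nat) \<Rightarrow> bool" where
  "latin_square n L \<longleftrightarrow>
     (\<forall>i<n. \<forall>j<n. L i j < n) \<and>
     (\<forall>i<n. \<forall>s<n. \<exists>!j. j < n \<and> L i j = s) \<and>
     (\<forall>j<n. \<forall>s<n. \<exists>!i. i < n \<and> L i j = s)"

type_synonym perm_triple = "(nat \<Rightarrow> nat) \<times> (nat \<Rightarrow> nat) \<times> (nat \<Rightarrow> nat)"

fun isotope :: "(nat \<Rightarrow> nat \<Rightarrow> nat) \<Rightarrow> perm_triple \<Rightarrow> nat \<Rightarrow> nat \<Rightarrow> nat" where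
  "isotope L (\<alpha>, \<beta>, \<gamma>) i j = inv \<gamma> (L (\<alpha> i) (\<beta> j))"

definition autotopism :: "nat \<Rightarrow> (nat \<Rightarrow> nat \<Rightarrow> nat) \<Rightarrow> perm_triple \<Rightarrow> bool" where
  "autotopism n L \<Theta> \<longleftrightarrow>
     (case \<Theta> of (\<alpha>, \<beta>, \<gamma>) \<Rightarrow>
        \<alpha> permutes {..<n} \<and> \<beta> permutes {..<n} \<and> \<gamma> permutes {..<n}) \<and>
     (\<forall>i<n. \<forall>j<n. isotope L \<Theta> i j = L i j)"

text \<open>
  A cycle is represented by its underlying set, so its length is the cardinality of that set;
  a fixed point \<open>x\<close> gives the cycle \<open>{x}\<close>.  The inclusion in \<open>{..<n}\<close> excludes the fixed
  points of \<open>f\<close> outside the permuted set.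
\<close>

definition perm_cycle :: "nat \<Rightarrow> (nat \<Rightarrow> nat) \<Rightarrow> nat set \<Rightarrow> bool" where
  "perm_cycle n f C \<longleftrightarrow> C \<subseteq> {..<n} \<and> cyclic_on f C"

end

theory Submission
  imports Defs "HOL-Combinatorics.Cycles"
begin

text \<open>
  For \<open>x\<close> in a cycle \<open>C\<close> of \<open>f\<close>, the power \<open>f\<^sup>k\<close> fixes \<open>x\<close> iff \<open>card C\<close> divides \<open>k\<close>.
  Since \<open>\<gamma>\<^sup>k\<close> maps the entry in cell \<open>(a, b)\<close> to the entry in cell \<open>(\<alpha>\<^sup>k a, \<beta>\<^sup>k b)\<close>, the
  Latin property shows that any two of \<open>\<alpha>\<^sup>k a = a\<close>, \<open>\<beta>\<^sup>k b = b\<close> and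
  \<open>\<gamma>\<^sup>k (L a b) = L a b\<close> imply the third.  So any two of the three cycle lengths have the
  same common multiples as all three of them, and the claims are arithmetic.
\<close>

text \<open>The iterates of \<open>x\<close> before its first return are distinct and exhaust the
  orbit, so the return time is \<open>card C\<close>. Reducing \<open>k\<close> modulo it leaves an
  earlier return unless the remainder is 0.\<close>

lemma funpow_eq_self_iff_card_dvd:
  assumes "cyclic_on f C" and "x \<in> C"
  shows "(f ^^ k) x = x \<longleftrightarrow> card C dvd k"
proof -
  define p where "p = funpow_dist1 f x x"
  have C: "orbit f x = C"
    using assms by (rule orbit_cyclic_eq3)
  with \<open>x \<in> C\<close> have x: "x \<in> orbit f x"
    by simp
  have period: "(f ^^ p) x = x"
    unfolding p_def using x by (rule funpow_dist1_prop)
  have "C = (\<lambda>i. (f ^^ i) x) ` {0..<p}"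
    using orbit_conv_funpow_dist1[OF x] C by (simp add: p_def)
  then have "card C = p"
    using card_image[OF inj_on_funpow_dist1[OF x]] by (simp add: p_def)
  moreover have "(f ^^ k) x = (f ^^ (k mod p)) x"
    using period by (simp add: funpow_mod_eq)
  moreover have "(f ^^ (k mod p)) x = x \<longleftrightarrow> k mod p = 0"
  proof
    assume fixed: "(f ^^ (k mod p)) x = x"
    show "k mod p = 0"
    proof (rule ccontr)
      assume "k mod p \<noteq> 0"
      \<comment> \<open>\<open>funpow_dist1\<close> is a successor, so \<open>p\<close> is positive
        and bounds the remainder strictly.\<close>
      then have "0 < k mod p" and "k mod p < funpow_dist1 f x x"
        by (simp_all add: p_def)
      then have "(f ^^ (k mod p)) x \<noteq> x"
        by (rule funpow_dist1_least)
      with fixed show False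
        by contradiction
    qed
  qed simp
  ultimately show ?thesis
    by (simp add: dvd_eq_mod_eq_0)
qed

lemma latin_square_row_cancel:
  assumes "latin_square n L" and "i < n" "j < n" "j' < n" and "L i j = L i j'"
  shows "j = j'"
proof -
  have "L i j < n" and "\<And>s. s < n \<Longrightarrow> \<exists>!x. x < n \<and> L i x = s"
    using assms(1-3) by (simp_all add: latin_square_def)
  then have "\<exists>!x. x < n \<and> L i x = L i j"
    by simp
  then show ?thesis
    by (rule ex1E) (use assms(3-5) in metis)
qed

lemma latin_square_column_cancel:
  assumes "latin_square n L" and "i < n" "i' < n" "j < n" and "L i j = L i' j"
  shows "i = i'"
proof -
  have "L i j < n" and "\<And>s. s < n \<Longrightarrow> \<exists>!x. x < n \<and> L x j = s"
    using assms(1,2,4) by (simp_all add: latin_square_def)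
  then have "\<exists>!x. x < n \<and> L x j = L i j"
    by simp
  then show ?thesis
    by (rule ex1E) (use assms(2,3,5) in metis)
qed

text \<open>Applying \<open>\<gamma>\<close> cancels the inverse in \<open>isotope\<close> and gives
  a form that can be iterated.\<close>

lemma autotopism_entry:
  assumes "autotopism n L (\<alpha>, \<beta>, \<gamma>)" and "i < n" "j < n"
  shows "\<gamma> (L i j) = L (\<alpha> i) (\<beta> j)"
proof -
  have "\<gamma> permutes {..<n}" and "inv \<gamma> (L (\<alpha> i) (\<beta> j)) = L i j"
    using assms by (auto simp: autotopism_def)
  then show ?thesis
    by (metis permutes_inverses(1))
qed

text \<open>Keeps the iterated indices in the range where the Latin and autotopism conditions
  apply.\<close>

lemma autotopism_funpow_less:
  assumes "autotopism n L (\<alpha>, \<beta>, \<gamma>)" and "i < n" "j < n"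
  shows "(\<alpha> ^^ k) i < n" "(\<beta> ^^ k) j < n"
proof -
  have "\<alpha> ^^ k permutes {..<n}" and "\<beta> ^^ k permutes {..<n}"
    using assms(1) by (auto simp: autotopism_def intro: permutes_funpow)
  then show "(\<alpha> ^^ k) i < n" "(\<beta> ^^ k) j < n"
    using assms(2,3) permutes_in_image by fastforce+
qed

lemma autotopism_funpow_entry:
  assumes "autotopism n L (\<alpha>, \<beta>, \<gamma>)" and "i < n" "j < n"
  shows "(\<gamma> ^^ k) (L i j) = L ((\<alpha> ^^ k) i) ((\<beta> ^^ k) j)"
proof (induction k)
  case (Suc k)
  then show ?case
    using autotopism_entry[OF assms(1) autotopism_funpow_less[OF assms]] by simp
qed simp

theorem theorem2:
  fixes n :: nat
    and L :: "nat \<Rightarrow> nat \<Rightarrow> nat"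
    and \<alpha> \<beta> \<gamma> :: "nat \<Rightarrow> nat"
    and C\<^sub>\<alpha> C\<^sub>\<beta> C\<^sub>\<gamma> :: "nat set"
    and a b l\<^sub>\<alpha> l\<^sub>\<beta> l\<^sub>\<gamma> m :: nat
  assumes "latin_square n L"
    and "autotopism n L (\<alpha>, \<beta>, \<gamma>)"
    and "perm_cycle n \<alpha> C\<^sub>\<alpha>" and "l\<^sub>\<alpha> = card C\<^sub>\<alpha>"
    and "perm_cycle n \<beta> C\<^sub>\<beta>" and "l\<^sub>\<beta> = card C\<^sub>\<beta>"
    and "m = lcm l\<^sub>\<alpha> l\<^sub>\<beta>"
    and "a \<in> C\<^sub>\<alpha>" and "b \<in> C\<^sub>\<beta>"
    and "perm_cycle n \<gamma> C\<^sub>\<gamma>" and "L a b \<in> C\<^sub>\<gamma>" and "l\<^sub>\<gamma> = card C\<^sub>\<gamma>"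
  shows "l\<^sub>\<gamma> dvd m \<and>
         (\<forall>k. 0 < k \<and> l\<^sub>\<alpha> dvd k \<and> k < m \<longrightarrow> \<not> l\<^sub>\<gamma> dvd k) \<and>
         (\<forall>k. 0 < k \<and> l\<^sub>\<beta> dvd k \<and> k < m \<longrightarrow> \<not> l\<^sub>\<gamma> dvd k) \<and>
         (gcd l\<^sub>\<alpha> l\<^sub>\<beta> = 1 \<longrightarrow> l\<^sub>\<gamma> = m)"
proof -
  have cycles: "cyclic_on \<alpha> C\<^sub>\<alpha>" "cyclic_on \<beta> C\<^sub>\<beta>" "cyclic_on \<gamma> C\<^sub>\<gamma>"
    and less: "a < n" "b < n"
    using assms(3,5,8,9,10) by (auto simp: perm_cycle_def)
  note fix_\<alpha> = funpow_eq_self_iff_card_dvd[OF cycles(1) assms(8), folded assms(4)]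
  note fix_\<beta> = funpow_eq_self_iff_card_dvd[OF cycles(2) assms(9), folded assms(6)]
  note fix_\<gamma> = funpow_eq_self_iff_card_dvd[OF cycles(3) assms(11), folded assms(12)]
  note entry = autotopism_funpow_entry[OF assms(2) less]
  note less_k = autotopism_funpow_less[OF assms(2) less]
  \<comment> \<open>The flipped rules turn each divisibility into a fixed point of a
    \<open>k\<close>-th power; \<open>entry\<close> then carries it from row and column to
    symbol.\<close>
  have \<gamma>_dvd: "l\<^sub>\<gamma> dvd k" if "l\<^sub>\<alpha> dvd k" "l\<^sub>\<beta> dvd k" for k
    using that entry[of k] by (simp flip: fix_\<alpha> fix_\<beta> fix_\<gamma>)
  have \<beta>_dvd: "l\<^sub>\<beta> dvd k" if "l\<^sub>\<alpha> dvd k" "l\<^sub>\<gamma> dvd k" for k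
  proof -
    \<comment> \<open>Row \<open>a\<close> and the symbol are fixed, so this symbol sits in row
      \<open>a\<close> at both columns, which must coincide.\<close>
    have "L a ((\<beta> ^^ k) b) = L a b"
      using that entry[of k] by (simp flip: fix_\<alpha> fix_\<gamma>)
    then show ?thesis
      using latin_square_row_cancel[OF assms(1) less(1) less_k(2) less(2)] fix_\<beta> by simp
  qed
  have \<alpha>_dvd: "l\<^sub>\<alpha> dvd k" if "l\<^sub>\<beta> dvd k" "l\<^sub>\<gamma> dvd k" for k
  proof -
    \<comment> \<open>The same argument within column \<open>b\<close>.\<close>
    have "L ((\<alpha> ^^ k) a) b = L a b"
      using that entry[of k] by (simp flip: fix_\<beta> fix_\<gamma>)
    then show ?thesis
      using latin_square_column_cancel[OF assms(1) less_k(1) less] fix_\<alpha> by simp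
  qed
  have "l\<^sub>\<gamma> dvd m"
    unfolding assms(7) by (intro \<gamma>_dvd) simp_all
  moreover have "\<not> l\<^sub>\<gamma> dvd k" if "0 < k" "l\<^sub>\<alpha> dvd k" "k < m" for k
  proof
    assume "l\<^sub>\<gamma> dvd k"
    \<comment> \<open>By \<open>\<beta>_dvd\<close>, \<open>k\<close> is a common multiple of both
      lengths whose lcm is \<open>m\<close>.\<close>
    then have "m dvd k"
      using that \<beta>_dvd unfolding assms(7) by (intro lcm_least) simp_all
    then show False
      using that by (simp add: nat_dvd_not_less)
  qed
  moreover have "\<not> l\<^sub>\<gamma> dvd k" if "0 < k" "l\<^sub>\<beta> dvd k" "k < m" for k
  proof
    assume "l\<^sub>\<gamma> dvd k"
    then have "m dvd k"
      using that \<alpha>_dvd unfolding assms(7) by (intro lcm_least) simp_all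
    then show False
      using that by (simp add: nat_dvd_not_less)
  qed
  moreover have "l\<^sub>\<gamma> = m" if "gcd l\<^sub>\<alpha> l\<^sub>\<beta> = 1"
  proof (rule dvd_antisym)
    have coprime: "coprime l\<^sub>\<alpha> l\<^sub>\<beta>"
      using that by (simp add: coprime_iff_gcd_eq_1)
    \<comment> \<open>Each product is a common multiple of two lengths, hence a multiple of the
      third; coprimality then strips the factor other than \<open>l\<^sub>\<gamma>\<close>.\<close>
    have "l\<^sub>\<beta> dvd l\<^sub>\<alpha> * l\<^sub>\<gamma>" and "l\<^sub>\<alpha> dvd l\<^sub>\<beta> * l\<^sub>\<gamma>"
      by (simp_all add: \<alpha>_dvd \<beta>_dvd)
    then have "l\<^sub>\<beta> dvd l\<^sub>\<gamma>" and "l\<^sub>\<alpha> dvd l\<^sub>\<gamma>"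
      using coprime by (simp_all add: coprime_dvd_mult_right_iff coprime_commute)
    then show "m dvd l\<^sub>\<gamma>"
      by (simp add: assms(7))
  qed fact
  ultimately show ?thesis
    by blast
qed

end
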